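(* Let $a,b,c\in\mathbb{C}$. (1) If $a\neq\frac{3}{2}$, then all conformal derivations of $TSV(a,b)$ are inner, i.e. $\mathrm{CDer}(TSV(a,b))=\mathrm{CInn}(TSV(a,b))$. If $a=\frac{3}{2}$, then for any $b_0\in\mathbb{C}\setminus\{0\}$ there is a non-inner conformal derivation $R=R^{(b_0)}$ of $TSV(\frac32,b)$ given by $R_\lambda(L)=b_0M$, $R_\lambda(M)=R_\lambda(Y)=0$. Let $T=\{R^{(b_0)}:b_0\in\mathbb{C}\}$ be the vector space of all such $R$ (with $R^{(0)}=0$). Then $$\mathrm{CDer}\left(TSV(\tfrac32,b)\right)=\mathrm{CInn}\left(TSV(\tfrac32,b)\right)\oplus T.$$ (2) All conformal derivations of $TSV(c)$ are inner, i.e. $\mathrm{CDer}(TSV(c))=\mathrm{CInn}(TSV(c))$.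
   Context: A Lie conformal algebra $R$ is a $\mathbb{C}[\partial]$-module with a $\mathbb{C}$-bilinear $\lambda$-bracket $[\cdot_\lambda\cdot]:R\otimes R\to R[\lambda]$ such that for all $x,y,z\in R$: $[\partial x_\lambda y]=-\lambda[x_\lambda y]$, $[x_\lambda\partial y]=(\lambda+\partial)[x_\lambda y]$; $[x_\lambda y]=-[y_{-\lambda-\partial}x]$ (skew-symmetry); $[x_\lambda[y_\mu z]]=[[x_\lambda y]_{\lambda+\mu}z]+[y_\mu[x_\lambda z]]$ (Jacobi identity). For $a,b\in\mathbb{C}$, $TSV(a,b)=\mathbb{C}[\partial]L\oplus\mathbb{C}[\partial]M\oplus\mathbb{C}[\partial]Y$ is the Lie conformal algebra, free over $\mathbb{C}[\partial]$ with basis $L,M,Y$, with $\lambda$-brackets $$[L_\lambda L]=(\partial+2\lambda)L,\quad [L_\lambda Y]=(\partial+a\lambda+b)Y,\quad [L_\lambda M]=(\partial+2(a-1)\lambda+2b)M,$$ $$[Y_\lambda Y]=(\partial+2\lambda)M,\quad [Y_\lambda M]=[M_\lambda M]=0.$$ For $c\in\mathbb{C}$, $TSV(c)=\mathbb{C}[\partial]L\oplus\mathbb{C}[\partial]M\oplus\mathbb{C}[\partial]Y$ is the Lie conformal algebra, free over $\mathbb{C}[\partial]$ with basis $L,M,Y$, with $\lambda$-brackets $$[L_\lambda L]=(\partial+2\lambda)L,\quad [L_\lambda Y]=\left(\partial+\tfrac{3}{2}\lambda+c\right)Y,\quad [L_\lambda M]=(\partial+2c)M,$$ $$[Y_\lambda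 Y]=(\partial+2\lambda)(-\partial-2c)M,\quad [Y_\lambda M]=[M_\lambda M]=0.$$ In both cases the remaining brackets of basis elements are determined by skew-symmetry. A conformal linear map between $\mathbb{C}[\partial]$-modules $U$ and $V$ is a $\mathbb{C}$-linear map $\phi_\lambda:U\to V[\lambda]$ with $\phi_\lambda(\partial u)=(\partial+\lambda)\phi_\lambda(u)$ for all $u\in U$. A conformal derivation of a Lie conformal algebra $R$ is a conformal linear map $d$ from $R$ to $R$ such that $d_\lambda[x_\mu y]=[(d_\lambda x)_{\lambda+\mu}y]+[x_\mu(d_\lambda y)]$ for all $x,y\in R$. The space of all conformal derivations is $\mathrm{CDer}(R)$. For $x\in R$, the conformal derivation $\mathrm{ad}\,x$ is given by $(\mathrm{ad}\,x)_\lambda y=[x_\lambda y]$; derivations of this kind are called inner, and $\mathrm{CInn}(R)$ is the space of all of them. *)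

theory Defs
  imports Complex_Main "HOL-Computational_Algebra.Polynomial" "HOL-Library.Function_Algebras"
begin

section \<open>Polynomials with coefficients in a \<open>\<complex>[\<partial>]\<close>-module\<close>

text \<open>
  A \<open>\<complex>[\<partial>]\<close>-module is an additive group \<^typ>\<open>'a\<close> with a scalar multiplication by
  \<^typ>\<open>complex poly\<close>, the polynomial variable being \<open>\<partial>\<close>. Then \<open>R[\<lambda>]\<close> is
  \<^typ>\<open>'a poly\<close>, and \<open>\<complex>[\<partial>][\<lambda>]\<close>, which acts on it, is \<^typ>\<open>complex poly poly\<close>.
\<close>

definition del :: "complex poly poly" where
  "del = [:[:0, 1:]:]"

definition lam :: "complex poly poly" where
  "lam = [:0, 1:]"

definition cst :: "complex \<Rightarrow> complex poly poly" where
  "cst c = [:[:c:]:]"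

definition act ::
  "(complex poly \<Rightarrow> 'a \<Rightarrow> 'a) \<Rightarrow> complex poly poly \<Rightarrow> 'a poly \<Rightarrow> 'a::ab_group_add poly" where
  "act scale q p =
     (\<Sum>i\<le>degree q. \<Sum>j\<le>degree p. monom (scale (coeff q i) (coeff p j)) (i + j))"

text \<open>
  Substitution of an operator \<^term>\<open>T\<close> for the variable of \<open>p(\<lambda>) = \<Sum>\<^sub>n \<lambda>\<^sup>n p\<^sub>n\<close>, the
  coefficients being mapped by \<^term>\<open>f\<close>: the result is \<open>\<Sum>\<^sub>n T\<^sup>n (f p\<^sub>n)\<close>.
\<close>

definition subst_op :: "('a \<Rightarrow> 'b) \<Rightarrow> ('b \<Rightarrow> 'b) \<Rightarrow> 'a::zero poly \<Rightarrow> 'b::comm_monoid_add" where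
  "subst_op f T p = (\<Sum>n\<le>degree p. (T ^^ n) (f (coeff p n)))"

text \<open>
  \<open>R[\<lambda>,\<mu>]\<close> is \<^typ>\<open>'a poly poly\<close>, with outer variable \<open>\<lambda>\<close> and inner variable \<open>\<mu>\<close>.
\<close>

definition Const2 :: "'a \<Rightarrow> 'a::zero poly poly" where
  "Const2 u = [:[:u:]:]"

definition Lam :: "'a poly poly \<Rightarrow> 'a::zero poly poly" where
  "Lam p = pCons 0 p"

definition Mu :: "'a poly poly \<Rightarrow> 'a::zero poly poly" where
  "Mu p = map_poly (pCons 0) p"

definition LamMu :: "'a poly poly \<Rightarrow> 'a::comm_monoid_add poly poly" where
  "LamMu p = Lam p + Mu p"

text \<open>
  For a map \<open>B\<^sub>\<lambda> : R \<rightarrow> R[\<lambda>]\<close> and \<open>p(\<nu>) \<in> R[\<nu>]\<close>, \<open>comp2 B S p T\<close> is \<open>B\<^sub>S (p(T)) \<in> R[\<lambda>,\<mu>]\<close>,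
  where \<open>S\<close> and \<open>T\<close> are polynomials in \<open>\<lambda>, \<mu>\<close>, given as multiplication operators, and
  \<open>B\<^sub>S\<close> is extended linearly over the variables. For instance \<open>[x\<^sub>\<lambda> [y\<^sub>\<mu> z]]\<close> is
  \<open>comp2 (br x) Lam (br y z) Mu\<close>.
\<close>

definition comp2 ::
  "('a \<Rightarrow> 'a poly) \<Rightarrow> ('a poly poly \<Rightarrow> 'a poly poly) \<Rightarrow>
   'a poly \<Rightarrow> ('a poly poly \<Rightarrow> 'a poly poly) \<Rightarrow> 'a::comm_monoid_add poly poly" where
  "comp2 B S p T = subst_op (\<lambda>u. subst_op Const2 S (B u)) T p"


section \<open>Lie conformal algebras and conformal derivations\<close>

text \<open>The right-hand side \<open>- p(-\<lambda>-\<partial>)\<close> of skew-symmetry, powers of \<open>\<partial>\<close> acting from the left.\<close>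

definition skew :: "(complex poly \<Rightarrow> 'a \<Rightarrow> 'a) \<Rightarrow> 'a poly \<Rightarrow> 'a::ab_group_add poly" where
  "skew scale p = - subst_op (\<lambda>u. [:u:]) (act scale (- lam - del)) p"

locale lie_conformal_algebra = module scale
  for scale :: "complex poly \<Rightarrow> 'a \<Rightarrow> 'a::ab_group_add" +
  fixes br :: "'a \<Rightarrow> 'a \<Rightarrow> 'a poly"
  assumes br_add_left: "br (x + y) z = br x z + br y z"
    and br_add_right: "br x (y + z) = br x y + br x z"
    and br_scale_left: "br (scale [:c:] x) y = act scale (cst c) (br x y)"
    and br_scale_right: "br x (scale [:c:] y) = act scale (cst c) (br x y)"
    and br_del_left: "br (scale [:0, 1:] x) y = act scale (- lam) (br x y)"
    and br_del_right: "br x (scale [:0, 1:] y) = act scale (lam + del) (br x y)"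
    and br_skew: "br x y = skew scale (br y x)"
    and jacobi: "comp2 (br x) Lam (br y z) Mu =
      comp2 (\<lambda>u. br u z) LamMu (br x y) Lam + comp2 (br y) Mu (br x z) Lam"

definition conformal_linear ::
  "(complex poly \<Rightarrow> 'a \<Rightarrow> 'a) \<Rightarrow> (complex poly \<Rightarrow> 'b \<Rightarrow> 'b) \<Rightarrow>
   ('a::ab_group_add \<Rightarrow> 'b::ab_group_add poly) \<Rightarrow> bool" where
  "conformal_linear scaleU scaleV \<phi> \<longleftrightarrow>
     (\<forall>u v. \<phi> (u + v) = \<phi> u + \<phi> v) \<and>
     (\<forall>c u. \<phi> (scaleU [:c:] u) = act scaleV (cst c) (\<phi> u)) \<and>
     (\<forall>u. \<phi> (scaleU [:0, 1:] u) = act scaleV (del + lam) (\<phi> u))"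

definition conformal_derivation ::
  "(complex poly \<Rightarrow> 'a \<Rightarrow> 'a) \<Rightarrow> ('a \<Rightarrow> 'a \<Rightarrow> 'a poly) \<Rightarrow>
   ('a::ab_group_add \<Rightarrow> 'a poly) \<Rightarrow> bool" where
  "conformal_derivation scale br d \<longleftrightarrow>
     conformal_linear scale scale d \<and>
     (\<forall>x y. comp2 d Lam (br x y) Mu =
        comp2 (\<lambda>u. br u y) LamMu (d x) Lam + comp2 (br x) Mu (d y) Lam)"

definition CDer ::
  "(complex poly \<Rightarrow> 'a \<Rightarrow> 'a) \<Rightarrow> ('a \<Rightarrow> 'a \<Rightarrow> 'a poly) \<Rightarrow> ('a::ab_group_add \<Rightarrow> 'a poly) set" where
  "CDer scale br = {d. conformal_derivation scale br d}"

definition conf_ad :: "('a \<Rightarrow> 'a \<Rightarrow> 'a poly) \<Rightarrow> 'a \<Rightarrow> 'a \<Rightarrow> 'a::ab_group_add poly" where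
  "conf_ad br x = (\<lambda>y. br x y)"

definition CInn :: "('a \<Rightarrow> 'a \<Rightarrow> 'a poly) \<Rightarrow> ('a::ab_group_add \<Rightarrow> 'a poly) set" where
  "CInn br = range (conf_ad br)"

definition cscale ::
  "(complex poly \<Rightarrow> 'b \<Rightarrow> 'b) \<Rightarrow> complex \<Rightarrow> ('a \<Rightarrow> 'b poly) \<Rightarrow> 'a \<Rightarrow> 'b::ab_group_add poly" where
  "cscale scale c \<phi> = (\<lambda>x. act scale (cst c) (\<phi> x))"

definition is_direct_sum ::
  "('k::field \<Rightarrow> 'v \<Rightarrow> 'v) \<Rightarrow> 'v::ab_group_add set \<Rightarrow> 'v set \<Rightarrow> 'v set \<Rightarrow> bool" where
  "is_direct_sum s V A B \<longleftrightarrow>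
     module.subspace s V \<and> module.subspace s A \<and> module.subspace s B \<and>
     V = {u + v | u v. u \<in> A \<and> v \<in> B} \<and> A \<inter> B = {0}"


section \<open>Free modules of finite rank\<close>

definition fscale :: "complex poly \<Rightarrow> ('i \<Rightarrow> complex poly) \<Rightarrow> 'i \<Rightarrow> complex poly" where
  "fscale q x = (\<lambda>i. q * x i)"

definition bas :: "'i \<Rightarrow> 'i \<Rightarrow> complex poly" where
  "bas i = (\<lambda>j. if j = i then 1 else 0)"

text \<open>\<open>q(r)\<close> for \<open>q \<in> \<complex>[\<partial>]\<close> and \<open>r \<in> \<complex>[\<partial>][\<lambda>]\<close>\<close>

definition plug :: "complex poly \<Rightarrow> complex poly poly \<Rightarrow> complex poly poly" where
  "plug q r = poly (map_poly cst q) r"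

text \<open>
  The conformal linear map with prescribed values on the basis, and the sesquilinear
  \<open>\<lambda>\<close>-bracket with prescribed values on pairs of basis elements:
  \<open>\<phi>\<^sub>\<lambda>(f(\<partial>)e) = f(\<partial>+\<lambda>) \<phi>\<^sub>\<lambda>(e)\<close> and \<open>[f(\<partial>)e\<^sub>\<lambda> g(\<partial>)e'] = f(-\<lambda>) g(\<partial>+\<lambda>) [e\<^sub>\<lambda> e']\<close>.
\<close>

definition conf_ext ::
  "('i::finite \<Rightarrow> ('j \<Rightarrow> complex poly) poly) \<Rightarrow> ('i \<Rightarrow> complex poly) \<Rightarrow> ('j \<Rightarrow> complex poly) poly" where
  "conf_ext v x = (\<Sum>i\<in>UNIV. act fscale (plug (x i) (del + lam)) (v i))"

definition sesq_ext ::
  "('i::finite \<Rightarrow> 'i \<Rightarrow> ('i \<Rightarrow> complex poly) poly) \<Rightarrow>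
   ('i \<Rightarrow> complex poly) \<Rightarrow> ('i \<Rightarrow> complex poly) \<Rightarrow> ('i \<Rightarrow> complex poly) poly" where
  "sesq_ext P x y =
     (\<Sum>i\<in>UNIV. \<Sum>j\<in>UNIV. act fscale (plug (x i) (- lam) * plug (y j) (del + lam)) (P i j))"


section \<open>The Lie conformal algebras \<open>TSV(a,b)\<close> and \<open>TSV(c)\<close>\<close>

datatype gen = GL | GM | GY

lemma UNIV_gen: "(UNIV :: gen set) = {GL, GM, GY}"
  by (auto intro: gen.exhaust)

instance gen :: finite
  by standard (simp add: UNIV_gen)

type_synonym tsv = "gen \<Rightarrow> complex poly"

definition mul :: "complex poly poly \<Rightarrow> gen \<Rightarrow> tsv poly" where
  "mul q g = act fscale q [:bas g:]"

fun TSV_table :: "complex \<Rightarrow> complex \<Rightarrow> gen \<Rightarrow> gen \<Rightarrow> tsv poly" where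
  "TSV_table a b GL GL = mul (del + 2 * lam) GL"
| "TSV_table a b GL GY = mul (del + cst a * lam + cst b) GY"
| "TSV_table a b GL GM = mul (del + cst (2 * (a - 1)) * lam + cst (2 * b)) GM"
| "TSV_table a b GY GY = mul (del + 2 * lam) GM"
| "TSV_table a b GY GM = 0"
| "TSV_table a b GM GM = 0"
| "TSV_table a b GY GL = skew fscale (mul (del + cst a * lam + cst b) GY)"
| "TSV_table a b GM GL = skew fscale (mul (del + cst (2 * (a - 1)) * lam + cst (2 * b)) GM)"
| "TSV_table a b GM GY = skew fscale 0"

definition TSV :: "complex \<Rightarrow> complex \<Rightarrow> tsv \<Rightarrow> tsv \<Rightarrow> tsv poly" where
  "TSV a b = sesq_ext (TSV_table a b)"

fun TSVc_table :: "complex \<Rightarrow> gen \<Rightarrow> gen \<Rightarrow> tsv poly" where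
  "TSVc_table c GL GL = mul (del + 2 * lam) GL"
| "TSVc_table c GL GY = mul (del + cst (3/2) * lam + cst c) GY"
| "TSVc_table c GL GM = mul (del + cst (2 * c)) GM"
| "TSVc_table c GY GY = mul ((del + 2 * lam) * (- del - cst (2 * c))) GM"
| "TSVc_table c GY GM = 0"
| "TSVc_table c GM GM = 0"
| "TSVc_table c GY GL = skew fscale (mul (del + cst (3/2) * lam + cst c) GY)"
| "TSVc_table c GM GL = skew fscale (mul (del + cst (2 * c)) GM)"
| "TSVc_table c GM GY = skew fscale 0"

definition TSVc :: "complex \<Rightarrow> tsv \<Rightarrow> tsv \<Rightarrow> tsv poly" where
  "TSVc c = sesq_ext (TSVc_table c)"

text \<open>The conformal linear map \<open>R\<^sub>\<lambda>(L) = b\<^sub>0 M\<close>, \<open>R\<^sub>\<lambda>(M) = R\<^sub>\<lambda>(Y) = 0\<close>\<close>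

definition Rder :: "complex \<Rightarrow> tsv \<Rightarrow> tsv poly" where
  "Rder b0 = conf_ext (\<lambda>g. if g = GL then [:fscale [:b0:] (bas GM):] else 0)"


section \<open>\<open>TSV(a,b)\<close> and \<open>TSV(c)\<close> are Lie conformal algebras\<close>

text \<open>
  An element of \<open>R[\<lambda>]\<close> or \<open>R[\<lambda>,\<mu>]\<close>, \<open>R\<close> free, is determined by the values of its components
  at complex numbers \<open>\<lambda> = l\<close>, \<open>\<mu> = m\<close>, \<open>\<partial> = t\<close>; the identities are checked on these.
\<close>

definition kcomp :: "'i \<Rightarrow> ('i \<Rightarrow> complex poly) poly \<Rightarrow> complex poly poly" where
  "kcomp k p = map_poly (\<lambda>u. u k) p"

definition ev1 :: "('i \<Rightarrow> complex poly) poly \<Rightarrow> complex \<Rightarrow> complex \<Rightarrow> 'i \<Rightarrow> complex" where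
  "ev1 p l t k = poly (poly (kcomp k p) [:l:]) t"

definition ev2 :: "('i \<Rightarrow> complex poly) poly poly \<Rightarrow> complex \<Rightarrow> complex \<Rightarrow> complex \<Rightarrow> 'i \<Rightarrow> complex" where
  "ev2 p l m t k = poly (poly (poly (map_poly (kcomp k) p) [:[:l:]:]) [:m:]) t"

lemma coeff_kcomp [simp]: "coeff (kcomp k p) n = coeff p n k"
  unfolding kcomp_def by (subst coeff_map_poly) auto

lemma kcomp_0 [simp]: "kcomp k 0 = 0"
  by (rule poly_eqI) simp

lemma kcomp_add [simp]: "kcomp k (p + q) = kcomp k p + kcomp k q"
  by (rule poly_eqI) simp

lemma kcomp_uminus [simp]: "kcomp k (- p) = - kcomp k p"
  by (rule poly_eqI) simp

lemma kcomp_sum [simp]: "kcomp k (sum f A) = (\<Sum>i\<in>A. kcomp k (f i))"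
  by (induction A rule: infinite_finite_induct) auto

lemma kcomp_pCons [simp]: "kcomp k (pCons u p) = pCons (u k) (kcomp k p)"
  by (rule poly_eqI) (auto simp: coeff_pCons split: nat.split)

lemma kcomp_monom [simp]: "kcomp k (monom u n) = monom (u k) n"
  by (rule poly_eqI) auto

lemma ev1_simps [simp]:
  "ev1 0 l t k = 0" "ev1 (p + q) l t k = ev1 p l t k + ev1 q l t k"
  "ev1 (- p) l t k = - ev1 p l t k" "ev1 [:u:] l t k = poly (u k) t"
  "ev1 (pCons u p) l t k = poly (u k) t + l * ev1 p l t k"
  by (simp_all add: ev1_def)

lemma ev1_sum: "ev1 (sum f A) l t k = (\<Sum>i\<in>A. ev1 (f i) l t k)"
  by (induction A rule: infinite_finite_induct) auto

lemma poly_poly_inj: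
  fixes p q :: "complex poly poly"
  assumes "\<And>l t. poly (poly p [:l:]) t = poly (poly q [:l:]) t"
  shows "p = q"
proof -
  have "poly (p - q) [:l:] = 0" for l
    using assms by (simp add: poly_eq_poly_eq_iff[symmetric] fun_eq_iff)
  then have "range (\<lambda>l. [:l:]) \<subseteq> {x. poly (p - q) x = 0}" by auto
  moreover have "infinite (range (\<lambda>l::complex. [:l:]))"
    by (simp add: finite_image_iff inj_def infinite_UNIV_char_0)
  ultimately have "p - q = 0" using poly_roots_finite finite_subset by blast
  then show ?thesis by simp
qed

lemma ev1_inj:
  assumes "\<And>l t k. ev1 p l t k = ev1 q l t k"
  shows "p = q"
proof -
  have "kcomp k p = kcomp k q" for k
    by (rule poly_poly_inj) (use assms in \<open>simp add: ev1_def\<close>)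
  then have "coeff p n k = coeff q n k" for n k by (metis coeff_kcomp)
  then show ?thesis by (simp add: poly_eq_iff fun_eq_iff)
qed

lemma ev1_expand: "ev1 p l t k = (\<Sum>i\<le>degree p. l ^ i * poly (coeff p i k) t)"
proof -
  have "ev1 p l t k = ev1 (\<Sum>i\<le>degree p. monom (coeff p i) i) l t k"
    by (simp add: poly_as_sum_of_monoms)
  then show ?thesis by (simp add: ev1_sum) (simp add: ev1_def poly_monom mult_ac)
qed

lemma ev1_act [simp]: "ev1 (act fscale q p) l t k = poly (poly q [:l:]) t * ev1 p l t k"
proof -
  have "poly (poly q [:l:]) t = poly (poly (\<Sum>i\<le>degree q. monom (coeff q i) i) [:l:]) t"
    by (simp add: poly_as_sum_of_monoms)
  then have 1: "poly (poly q [:l:]) t = (\<Sum>i\<le>degree q. l ^ i * poly (coeff q i) t)"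
    by (simp add: poly_sum poly_monom mult_ac)
  show ?thesis
    unfolding 1 ev1_expand[of p] act_def
    by (simp add: ev1_sum sum_product) (simp add: ev1_def poly_monom fscale_def power_add mult_ac)
qed

lemma ev1_subst:
  assumes T: "\<And>p l t k. ev1 (T p) l t k = \<tau> l t * ev1 p l t k"
  shows "ev1 (subst_op (\<lambda>u. [:u:]) T p) l t k = ev1 p (\<tau> l t) t k"
proof -
  have "ev1 ((T ^^ n) p) l t k = \<tau> l t ^ n * ev1 p l t k" for n p
    by (induction n) (auto simp: T)
  then show ?thesis by (simp add: subst_op_def ev1_sum ev1_expand[of p])
qed

lemma ev1_skew [simp]: "ev1 (skew fscale p) l t k = - ev1 p (- l - t) t k"
  unfolding skew_def
  by (simp, rule ev1_subst) (simp add: lam_def del_def)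

lemma ev2_add [simp]: "ev2 (p + q) l m t k = ev2 p l m t k + ev2 q l m t k"
proof -
  have "map_poly (kcomp k) (p + q) = map_poly (kcomp k) p + map_poly (kcomp k) q"
    by (rule poly_eqI) (simp add: coeff_map_poly)
  then show ?thesis by (simp add: ev2_def)
qed
lemma ev2_0 [simp]: "ev2 0 l m t k = 0" by (simp add: ev2_def)
lemma ev2_Lam [simp]: "ev2 (Lam p) l m t k = l * ev2 p l m t k"
  by (simp add: ev2_def Lam_def map_poly_pCons)
lemma ev2_Mu [simp]: "ev2 (Mu p) l m t k = m * ev2 p l m t k"
proof -
  have "map_poly (kcomp k) (Mu p) = smult [:0,1:] (map_poly (kcomp k) p)"
    by (rule poly_eqI) (simp add: coeff_map_poly Mu_def)
  then show ?thesis by (simp add: ev2_def)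
qed
lemma ev2_LamMu [simp]: "ev2 (LamMu p) l m t k = (l + m) * ev2 p l m t k"
  by (simp add: LamMu_def algebra_simps)
lemma ev2_Const2 [simp]: "ev2 (Const2 u) l m t k = poly (u k) t"
  by (simp add: ev2_def Const2_def map_poly_pCons)
lemma ev2_sum: "ev2 (sum f A) l m t k = (\<Sum>i\<in>A. ev2 (f i) l m t k)"
  by (induction A rule: infinite_finite_induct) auto

lemma ev2_subst:
  assumes T: "\<And>p l m t k. ev2 (T p) l m t k = \<tau> l m * ev2 p l m t k"
  shows "ev2 (subst_op f T p) l m t k = (\<Sum>i\<le>degree p. \<tau> l m ^ i * ev2 (f (coeff p i)) l m t k)"
proof -
  have "ev2 ((T ^^ n) p) l m t k = \<tau> l m ^ n * ev2 p l m t k" for n p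
    by (induction n) (auto simp: T)
  then show ?thesis by (simp add: subst_op_def ev2_sum)
qed

lemma ev2_comp2:
  assumes S: "\<And>p l m t k. ev2 (S p) l m t k = \<sigma> l m * ev2 p l m t k"
  assumes T: "\<And>p l m t k. ev2 (T p) l m t k = \<tau> l m * ev2 p l m t k"
  shows "ev2 (comp2 B S p T) l m t k =
    (\<Sum>i\<le>degree p. \<tau> l m ^ i * ev1 (B (coeff p i)) (\<sigma> l m) t k)"
  unfolding comp2_def ev2_subst[of T \<tau>, OF T] ev2_subst[of S \<sigma>, OF S]
  by (simp add: ev1_expand)

lemma ev2_inj:
  assumes "\<And>l m t k. ev2 p l m t k = ev2 q l m t k"
  shows "p = q"
proof -
  have "map_poly (kcomp k) p = map_poly (kcomp k) q" for k
  proof -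
    let ?p = "map_poly (kcomp k) p" and ?q = "map_poly (kcomp k) q"
    have "poly ?p [:[:l:]:] = poly ?q [:[:l:]:]" for l
      by (rule poly_poly_inj) (use assms in \<open>simp add: ev2_def\<close>)
    then have "range (\<lambda>l. [:[:l:]:]) \<subseteq> {x. poly (?p - ?q) x = 0}" by auto
    moreover have "infinite (range (\<lambda>l::complex. [:[:l:]:]))"
      by (simp add: finite_image_iff inj_def infinite_UNIV_char_0)
    ultimately have "?p - ?q = 0" using poly_roots_finite finite_subset by blast
    then show ?thesis by simp
  qed
  then have "coeff (coeff p n) i k = coeff (coeff q n) i k" for n i k
    by (metis coeff_kcomp coeff_map_poly kcomp_0)
  then show ?thesis by (simp add: poly_eq_iff fun_eq_iff)
qed

lemma poly_plug [simp]: "poly (poly (plug q r) [:l:]) t = poly q (poly (poly r [:l:]) t)"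
  unfolding plug_def
  by (induction q) (simp_all add: map_poly_pCons cst_def)

lemma ev1_sesq [simp]: "ev1 (sesq_ext P x y) l t k =
   (\<Sum>i\<in>UNIV. \<Sum>j\<in>UNIV. poly (x i) (- l) * poly (y j) (l + t) * ev1 (P i j) l t k)"
  by (simp add: sesq_ext_def ev1_sum lam_def del_def add_ac)

lemma ev1_conf [simp]: "ev1 (conf_ext v x) l t k =
   (\<Sum>i\<in>UNIV. poly (x i) (l + t) * ev1 (v i) l t k)"
  by (simp add: conf_ext_def ev1_sum lam_def del_def add_ac)

lemma ev2_comp2_right:
  assumes S: "\<And>p l m t k. ev2 (S p) l m t k = \<sigma> l m * ev2 p l m t k"
  assumes T: "\<And>p l m t k. ev2 (T p) l m t k = \<tau> l m * ev2 p l m t k"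
  shows "ev2 (comp2 (sesq_ext P x) S p T) l m t k =
    (\<Sum>i\<in>UNIV. \<Sum>j\<in>UNIV. poly (x i) (- \<sigma> l m) * ev1 p (\<tau> l m) (\<sigma> l m + t) j * ev1 (P i j) (\<sigma> l m) t k)"
  unfolding ev2_comp2[of S \<sigma> T \<tau>, OF S T] ev1_sesq ev1_expand[of p]
  apply (simp add: sum_distrib_left sum_distrib_right)
  apply (subst sum.swap[where A="{..degree p}"])
  apply (intro sum.cong refl)
  apply (subst sum.swap[where A="{..degree p}"])
  apply (intro sum.cong refl)
  apply (simp add: mult_ac)
  done

lemma ev2_comp2_left:
  assumes S: "\<And>p l m t k. ev2 (S p) l m t k = \<sigma> l m * ev2 p l m t k"
  assumes T: "\<And>p l m t k. ev2 (T p) l m t k = \<tau> l m * ev2 p l m t k"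
  shows "ev2 (comp2 (\<lambda>u. sesq_ext P u z) S p T) l m t k =
    (\<Sum>i\<in>UNIV. \<Sum>j\<in>UNIV. ev1 p (\<tau> l m) (- \<sigma> l m) i * poly (z j) (\<sigma> l m + t) * ev1 (P i j) (\<sigma> l m) t k)"
  unfolding ev2_comp2[of S \<sigma> T \<tau>, OF S T] ev1_sesq ev1_expand[of p]
  apply (simp add: sum_distrib_left sum_distrib_right)
  apply (subst sum.swap[where A="{..degree p}"])
  apply (intro sum.cong refl)
  apply (subst sum.swap[where A="{..degree p}"])
  apply (intro sum.cong refl)
  apply (simp add: mult_ac)
  done

lemma ev1_mul [simp]: "ev1 (mul q g) l t k = poly (poly q [:l:]) t * (if g = k then 1 else 0)"
  by (auto simp: mul_def bas_def)

lemma module_fscale: "module fscale"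
  by unfold_locales (auto simp: fscale_def algebra_simps fun_eq_iff)

lemma gsum: "(\<Sum>g\<in>(UNIV::gen set). f g) = f GL + f GM + f GY"
  by (simp add: UNIV_gen add_ac)

lemmas evs = lam_def del_def cst_def numeral_poly

lemma lc_sesq:
  fixes P :: "'i::finite \<Rightarrow> 'i \<Rightarrow> ('i \<Rightarrow> complex poly) poly"
  assumes sk: "\<And>i j l t k. ev1 (P i j) l t k = - ev1 (P j i) (- l - t) t k"
  assumes ja: "\<And>x y z. comp2 (sesq_ext P x) Lam (sesq_ext P y z) Mu =
      comp2 (\<lambda>u. sesq_ext P u z) LamMu (sesq_ext P x y) Lam + comp2 (sesq_ext P y) Mu (sesq_ext P x z) Lam"
  shows "lie_conformal_algebra fscale (sesq_ext P)"
proof -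
  interpret module fscale by (rule module_fscale)
  show ?thesis
  proof
    show "sesq_ext P x y = skew fscale (sesq_ext P y x)" for x y
      apply (rule ev1_inj)
      apply (simp add: sum_negf[symmetric])
      apply (subst sum.swap)
      apply (intro sum.cong refl)
      apply (subst sk)
      apply (simp add: mult_ac add.commute)
      done
  qed (rule ja | rule ev1_inj, simp add: fscale_def evs algebra_simps sum.distrib sum_distrib_left)+
qed

lemma lie_conformal_TSV: "lie_conformal_algebra fscale (TSV a b)"
  unfolding TSV_def
proof (rule lc_sesq)
  show "ev1 (TSV_table a b i j) l t k = - ev1 (TSV_table a b j i) (- l - t) t k" for i j l t k
    by (cases i; cases j) (simp_all add: evs algebra_simps)
  let ?P = "TSV_table a b"
  show "comp2 (sesq_ext ?P x) Lam (sesq_ext ?P y z) Mu =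
      comp2 (\<lambda>u. sesq_ext ?P u z) LamMu (sesq_ext ?P x y) Lam + comp2 (sesq_ext ?P y) Mu (sesq_ext ?P x z) Lam" for x y z
  proof (rule ev2_inj)
    fix l m t :: complex and k
    have e: "m + (l + t) = l + m + t" "l + (m + t) = l + m + t" "l + (- l - m) = - m" "- l - (- l - m) = m" by (simp_all add: algebra_simps)
    show "ev2 (comp2 (sesq_ext ?P x) Lam (sesq_ext ?P y z) Mu) l m t k =
      ev2 (comp2 (\<lambda>u. sesq_ext ?P u z) LamMu (sesq_ext ?P x y) Lam + comp2 (sesq_ext ?P y) Mu (sesq_ext ?P x z) Lam) l m t k"
    apply (simp only: ev2_add
       ev2_comp2_right[of Lam "\<lambda>l m. l" Mu "\<lambda>l m. m", OF ev2_Lam ev2_Mu]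
       ev2_comp2_right[of Mu "\<lambda>l m. m" Lam "\<lambda>l m. l", OF ev2_Mu ev2_Lam]
       ev2_comp2_left[of LamMu "\<lambda>l m. l + m" Lam "\<lambda>l m. l", OF ev2_LamMu ev2_Lam])
    apply (simp only: ev1_sesq gsum minus_add_distrib add_uminus_conv_diff e)
    apply (cases k)
    apply (simp_all add: evs)
    apply (simp_all add: algebra_simps add_divide_distrib diff_divide_distrib)
    done
  qed
qed

lemma lie_conformal_TSVc: "lie_conformal_algebra fscale (TSVc c)"
  unfolding TSVc_def
proof (rule lc_sesq)
  show "ev1 (TSVc_table c i j) l t k = - ev1 (TSVc_table c j i) (- l - t) t k" for i j l t k
    by (cases i; cases j) (simp_all add: evs algebra_simps)
  let ?P = "TSVc_table c"
  show "comp2 (sesq_ext ?P x) Lam (sesq_ext ?P y z) Mu =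
      comp2 (\<lambda>u. sesq_ext ?P u z) LamMu (sesq_ext ?P x y) Lam + comp2 (sesq_ext ?P y) Mu (sesq_ext ?P x z) Lam" for x y z
  proof (rule ev2_inj)
    fix l m t :: complex and k
    have e: "m + (l + t) = l + m + t" "l + (m + t) = l + m + t" "l + (- l - m) = - m" "- l - (- l - m) = m" by (simp_all add: algebra_simps)
    show "ev2 (comp2 (sesq_ext ?P x) Lam (sesq_ext ?P y z) Mu) l m t k =
      ev2 (comp2 (\<lambda>u. sesq_ext ?P u z) LamMu (sesq_ext ?P x y) Lam + comp2 (sesq_ext ?P y) Mu (sesq_ext ?P x z) Lam) l m t k"
    apply (simp only: ev2_add
       ev2_comp2_right[of Lam "\<lambda>l m. l" Mu "\<lambda>l m. m", OF ev2_Lam ev2_Mu]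
       ev2_comp2_right[of Mu "\<lambda>l m. m" Lam "\<lambda>l m. l", OF ev2_Mu ev2_Lam]
       ev2_comp2_left[of LamMu "\<lambda>l m. l + m" Lam "\<lambda>l m. l", OF ev2_LamMu ev2_Lam])
    apply (simp only: ev1_sesq gsum minus_add_distrib add_uminus_conv_diff e)
    apply (cases k)
    apply (simp_all add: evs)
    apply (simp_all add: algebra_simps add_divide_distrib diff_divide_distrib)
    done
  qed
qed

end

theory Submission
  imports Defs
begin

text \<open>
  Everything is evaluated at complex numbers \<open>\<lambda> = l\<close>, \<open>\<mu> = m\<close>, \<open>\<partial> = t\<close>. Write
  \<open>[L\<^sub>\<lambda> x] = (\<partial> + \<alpha>\<^sub>x \<lambda> + \<beta>\<^sub>x) x\<close> for basis elements \<open>x\<close>. For a derivation \<open>d\<close>, the identity for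
  \<open>d\<^sub>\<lambda>[L\<^sub>\<mu> L]\<close> at \<open>\<mu> = 0\<close> shows that the \<open>x\<close>-component \<open>p\<close> of \<open>d\<^sub>\<lambda> L\<close> satisfies
  \<open>(\<lambda> - \<beta>\<^sub>x) p(\<lambda>,\<partial>) = p(\<lambda>,-\<lambda>) ((\<alpha>\<^sub>x - 1) \<partial> + \<alpha>\<^sub>x \<lambda> - \<beta>\<^sub>x)\<close>. Dividing \<open>p(\<lambda>,-\<lambda>)\<close> by \<open>\<lambda> - \<beta>\<^sub>x\<close>
  exhibits \<open>p\<close> as the component of an inner derivation plus a constant, the constant being zero unless
  \<open>\<alpha>\<^sub>x = 1\<close>. After subtracting the inner derivation, the identity for \<open>d\<^sub>\<lambda>[L\<^sub>\<mu> g]\<close> at \<open>\<mu> = 0\<close>, with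
  \<open>g\<close> one of \<open>M, Y\<close>, becomes \<open>(\<lambda> + \<beta>\<^sub>g - \<beta>\<^sub>x) p = 0\<close> for the components of \<open>d\<^sub>\<lambda> g\<close>, except that the
  constant \<open>f\<close> in the \<open>Y\<close>-component of \<open>d\<^sub>\<lambda> L\<close> contributes \<open>f [Y\<^sub>\<lambda> Y]\<close> when \<open>g = Y\<close>; at
  \<open>\<lambda> = \<beta>\<^sub>M - \<beta>\<^sub>Y\<close> this forces \<open>f = 0\<close>. So only a constant multiple of \<open>M\<close> in \<open>d\<^sub>\<lambda> L\<close> can survive,
  and only if \<open>\<alpha>\<^sub>M = 1\<close>, which for \<open>TSV(a,b)\<close> means \<open>a = 3/2\<close>.
\<close>

section \<open>Conformal linear maps and derivations through their values\<close>

lemma ev1_minus [simp]: "ev1 (p - q) l t k = ev1 p l t k - ev1 q l t k"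
  by (metis add_diff_cancel_right' diff_add_cancel ev1_simps(2))

lemma ev1_cscale [simp]: "ev1 (cscale fscale c \<phi> x) l t k = c * ev1 (\<phi> x) l t k"
  by (simp add: cscale_def cst_def)

lemma poly_bas [simp]: "poly (bas i j) t = (if j = i then 1 else 0)"
  by (simp add: bas_def)

lemma module_cscale: "module (cscale fscale)"
  by unfold_locales (auto intro!: ext ev1_inj simp: algebra_simps)

text \<open>Constants and \<partial> generate all polynomials in \<partial>, so induction on
  \<open>q\<close> extends the two defining rules.\<close>

lemma conformal_linear_scale:
  fixes d :: "('i \<Rightarrow> complex poly) \<Rightarrow> ('j \<Rightarrow> complex poly) poly"
  assumes "conformal_linear fscale fscale d"
  shows "ev1 (d (fscale q x)) l t k = poly q (l + t) * ev1 (d x) l t k"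
proof (induction q)
  case 0
  have "d (fscale [:0:] x) = act fscale (cst 0) (d x)"
    using assms unfolding conformal_linear_def by blast
  then show ?case by (simp add: cst_def)
next
  case (pCons c q)
  have "fscale (pCons c q) x = fscale [:c:] x + fscale [:0, 1:] (fscale q x)"
    by (auto simp: fscale_def fun_eq_iff algebra_simps)
  then have "d (fscale (pCons c q) x) =
      act fscale (cst c) (d x) + act fscale (del + lam) (d (fscale q x))"
    using assms unfolding conformal_linear_def by metis
  then show ?case by (simp add: pCons.IH cst_def del_def lam_def algebra_simps)
qed

lemma conformal_linear_sum:
  fixes d :: "('i \<Rightarrow> complex poly) \<Rightarrow> ('j \<Rightarrow> complex poly) poly"
  assumes "conformal_linear fscale fscale d"
  shows "ev1 (d (sum f A)) l t k = (\<Sum>i\<in>A. ev1 (d (f i)) l t k)"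
proof -
  have 0: "d 0 = 0" and add: "\<And>u v. d (u + v) = d u + d v"
    using assms unfolding conformal_linear_def by (metis add_cancel_right_left)+
  show ?thesis
    by (induction A rule: infinite_finite_induct)
      (simp_all only: sum.infinite sum.empty sum.insert 0 add ev1_simps not_False_eq_True simp_thms)
qed

lemma conformal_linear_basis:
  fixes d :: "('i::finite \<Rightarrow> complex poly) \<Rightarrow> ('j \<Rightarrow> complex poly) poly"
  assumes "conformal_linear fscale fscale d"
  shows "ev1 (d x) l t k = (\<Sum>i\<in>UNIV. poly (x i) (l + t) * ev1 (d (bas i)) l t k)"
proof -
  have s: "(\<Sum>i\<in>A. fscale (x i) (bas i)) j = (\<Sum>i\<in>A. x i * bas i j)" for A j
    by (induction A rule: infinite_finite_induct) (auto simp: fscale_def)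
  have "x = (\<Sum>i\<in>UNIV. fscale (x i) (bas i))"
    by (rule ext) (unfold s, simp add: bas_def if_distrib cong: if_cong)
  then show ?thesis
    by (metis (no_types, lifting) conformal_linear_scale[OF assms] conformal_linear_sum[OF assms] sum.cong)
qed

text \<open>Moving \<open>d\<close> past \<partial> turns it into \<partial> + \<lambda>; hence
  \<open>p\<close> is evaluated at \<partial> = \<open>l + t\<close>.\<close>

lemma ev2_comp2_conf:
  fixes d :: "('i::finite \<Rightarrow> complex poly) \<Rightarrow> ('i \<Rightarrow> complex poly) poly"
  assumes "conformal_linear fscale fscale d"
  shows "ev2 (comp2 d Lam p Mu) l m t k =
    (\<Sum>i\<in>UNIV. ev1 p m (l + t) i * ev1 (d (bas i)) l t k)"
  unfolding ev2_comp2[of Lam "\<lambda>l m. l" Mu "\<lambda>l m. m", OF ev2_Lam ev2_Mu] ev1_expand[of p]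
    conformal_linear_basis[OF assms, of "coeff p _"]
  apply (simp add: sum_distrib_left sum_distrib_right)
  apply (subst sum.swap)
  apply (intro sum.cong refl)
  apply (simp add: mult_ac)
  done

lemma conformal_linear_conf_ext: "conformal_linear fscale fscale (conf_ext v)"
  unfolding conformal_linear_def
  by (intro conjI allI; rule ev1_inj)
    (simp_all add: fscale_def evs algebra_simps sum.distrib sum_distrib_left)

lemma conformal_linear_iff:
  fixes d :: "('i::finite \<Rightarrow> complex poly) \<Rightarrow> ('j \<Rightarrow> complex poly) poly"
  shows "conformal_linear fscale fscale d \<longleftrightarrow>
    (\<forall>x l t k. ev1 (d x) l t k = (\<Sum>i\<in>UNIV. poly (x i) (l + t) * ev1 (d (bas i)) l t k))"
proof
  assume r: "\<forall>x l t k. ev1 (d x) l t k = (\<Sum>i\<in>UNIV. poly (x i) (l + t) * ev1 (d (bas i)) l t k)"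
  define v where "v i = d (bas i)" for i
  have "d = conf_ext v"
    by (intro ext ev1_inj) (subst r[rule_format], simp flip: v_def)
  then show "conformal_linear fscale fscale d"
    by (simp only: conformal_linear_conf_ext)
qed (intro allI conformal_linear_basis)

text \<open>Values determine elements, so the derivation rule becomes a family of equations between
  complex numbers. The argument \<open>- (l + m)\<close> arises because \<partial> acts on the left
  entry of a bracket in \<lambda> + \<mu> as -(\<lambda> + \<mu>).\<close>

lemma conformal_derivation_iff:
  fixes d :: "('i::finite \<Rightarrow> complex poly) \<Rightarrow> ('i \<Rightarrow> complex poly) poly"
  shows "conformal_derivation fscale (sesq_ext P) d \<longleftrightarrow>
    (\<forall>x l t k. ev1 (d x) l t k = (\<Sum>i\<in>UNIV. poly (x i) (l + t) * ev1 (d (bas i)) l t k)) \<and>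
    (\<forall>x y l m t k.
      (\<Sum>i\<in>UNIV. ev1 (sesq_ext P x y) m (l + t) i * ev1 (d (bas i)) l t k) =
      (\<Sum>i\<in>UNIV. \<Sum>j\<in>UNIV. ev1 (d x) l (- (l + m)) i * poly (y j) (l + m + t) * ev1 (P i j) (l + m) t k) +
      (\<Sum>i\<in>UNIV. \<Sum>j\<in>UNIV. poly (x i) (- m) * ev1 (d y) l (m + t) j * ev1 (P i j) m t k))"
    (is "_ \<longleftrightarrow> ?lin \<and> ?der")
proof -
  have "(\<forall>x y. comp2 d Lam (sesq_ext P x y) Mu =
      comp2 (\<lambda>u. sesq_ext P u y) LamMu (d x) Lam + comp2 (sesq_ext P x) Mu (d y) Lam) \<longleftrightarrow> ?der"
    (is "(\<forall>x y. ?L x y = ?R x y) \<longleftrightarrow> _")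
    if "conformal_linear fscale fscale d"
  proof -
    have "?L x y = ?R x y \<longleftrightarrow> (\<forall>l m t k. ev2 (?L x y) l m t k = ev2 (?R x y) l m t k)" for x y
      by (metis ev2_inj)
    then show ?thesis
      by (simp only: ev2_add ev2_comp2_conf[OF that]
       ev2_comp2_right[of Mu "\<lambda>l m. m" Lam "\<lambda>l m. l", OF ev2_Mu ev2_Lam]
       ev2_comp2_left[of LamMu "\<lambda>l m. l + m" Lam "\<lambda>l m. l", OF ev2_LamMu ev2_Lam])
  qed
  then show ?thesis
    unfolding conformal_derivation_def conformal_linear_iff[symmetric] by (rule conj_cong[OF refl])
qed

section \<open>Subspaces, inner derivations and the maps \<open>Rder\<close>\<close>

lemma subspace_CDer: "module.subspace (cscale fscale) (CDer fscale (sesq_ext P))"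
  unfolding module.subspace_def[OF module_cscale] CDer_def mem_Collect_eq
proof (intro conjI ballI allI; (unfold mem_Collect_eq)?)
  show "conformal_derivation fscale (sesq_ext P) 0"
    by (simp add: conformal_derivation_iff)
next
  fix d d' assume "conformal_derivation fscale (sesq_ext P) d" "conformal_derivation fscale (sesq_ext P) d'"
  note D = this[unfolded conformal_derivation_iff]
  show "conformal_derivation fscale (sesq_ext P) (d + d')"
    unfolding conformal_derivation_iff
  proof (intro conjI allI, goal_cases)
    case (1 x l t k)
    show ?case
      using D(1)[THEN conjunct1, rule_format, of x l t k] D(2)[THEN conjunct1, rule_format, of x l t k]
      by (simp add: algebra_simps sum.distrib)
  next
    case (2 x y l m t k)
    show ?case
      using arg_cong2[OF D(1)[THEN conjunct2, rule_format, of x y m l t k]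
          D(2)[THEN conjunct2, rule_format, of x y m l t k], of "(+)"]
      by (simp add: algebra_simps sum.distrib del: ev1_sesq)
  qed
next
  fix c d assume "conformal_derivation fscale (sesq_ext P) d"
  note D = this[unfolded conformal_derivation_iff]
  show "conformal_derivation fscale (sesq_ext P) (cscale fscale c d)"
    unfolding conformal_derivation_iff
  proof (intro conjI allI, goal_cases)
    case (1 x l t k)
    show ?case
      using D[THEN conjunct1, rule_format, of x l t k]
      by (simp add: sum_distrib_left mult_ac)
  next
    case (2 x y l m t k)
    show ?case
      using arg_cong[OF D[THEN conjunct2, rule_format, of x y m l t k], of "(*) c"]
      by (simp add: sum_distrib_left distrib_left mult_ac del: ev1_sesq)
  qed
qed

lemma subspace_CInn:
  assumes "lie_conformal_algebra fscale br"
  shows "module.subspace (cscale fscale) (CInn br)"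
proof -
  interpret lie_conformal_algebra fscale br by fact
  have "br 0 = 0"
    using br_add_left[of 0 0] by (auto simp: fun_eq_iff)
  moreover have "br u + br v = br (u + v)" for u v
    by (rule ext) (simp add: br_add_left)
  moreover have "cscale fscale c (br u) = br (fscale [:c:] u)" for c u
    by (rule ext) (simp add: cscale_def br_scale_left)
  ultimately show ?thesis
    unfolding module.subspace_def[OF module_cscale] CInn_def conf_ad_def by (auto; metis rangeI)
qed

text \<open>The Jacobi identity is precisely the derivation rule for \<open>br x\<close>.\<close>

lemma CInn_subset_CDer:
  assumes "lie_conformal_algebra fscale br"
  shows "CInn br \<subseteq> CDer fscale br"
proof -
  interpret lie_conformal_algebra fscale br by fact
  show ?thesis
    by (auto simp: CInn_def conf_ad_def CDer_def conformal_derivation_def conformal_linear_def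
        br_add_right br_scale_right br_del_right jacobi add.commute[of del])
qed

lemma ev1_Rder [simp]: "ev1 (Rder e x) l t k = (if k = GM then e * poly (x GL) (l + t) else 0)"
  by (auto simp: Rder_def gsum fscale_def)

lemma Rder_0: "Rder 0 = 0"
  by (auto intro!: ext ev1_inj)

lemma Rder_basis:
  "Rder e (bas GL) = [:fscale [:e:] (bas GM):]" "Rder e (bas GM) = 0" "Rder e (bas GY) = 0"
  by (auto intro!: ev1_inj simp: fscale_def)

lemma subspace_Rder: "module.subspace (cscale fscale) {Rder e | e. True}"
proof -
  have "Rder e + Rder f = Rder (e + f)" "cscale fscale c (Rder e) = Rder (c * e)" for c e f
    by (auto intro!: ext ev1_inj simp: algebra_simps)
  then show ?thesis
    unfolding module.subspace_def[OF module_cscale] using Rder_0 by auto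
qed

section \<open>The polynomial equation for the value at \<open>L\<close>\<close>

text \<open>Pointwise division fails at \<open>l = \<beta>\<close>; the factor \<lambda> - \<beta>
  is cancelled in the integral domain of polynomials instead.\<close>

lemma poly_poly_cancel_linear:
  fixes p :: "complex poly poly"
  assumes "\<And>l t. (l - \<beta>) * poly (poly p [:l:]) t = 0"
  shows "p = 0"
proof -
  have "[:[:- \<beta>:], 1:] * p = 0"
    by (rule poly_poly_inj) (use assms in \<open>simp add: algebra_simps\<close>)
  then have "[:[:- \<beta>:], 1:] = (0 :: complex poly poly) \<or> p = 0"
    by (simp only: mult_eq_0_iff)
  then show ?thesis by simp
qed

lemma L_value_decomposition:
  fixes p :: "complex poly poly"
  assumes eq: "\<And>l t. (l - \<beta>) * poly (poly p [:l:]) t =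
    poly (poly p [:l:]) (- l) * ((\<alpha> - 1) * t + \<alpha> * l - \<beta>)"
  obtains g e where
    "\<And>l t. poly (poly p [:l:]) t = poly g (- l) * ((\<alpha> - 1) * t + \<alpha> * l - \<beta>) + e"
    "\<alpha> \<noteq> 1 \<Longrightarrow> e = 0"
proof -
  define h where "h = poly (map_poly (\<lambda>q. pcompose q [:0, - 1:]) p) [:0, 1:]"
  have h: "poly h l = poly (poly p [:l:]) (- l)" for l
    unfolding h_def by (induction p) (simp_all add: map_poly_pCons poly_pcompose)
  define e where "e = poly h \<beta>"
  have "poly (h - [:e:]) \<beta> = 0" by (simp add: e_def)
  then obtain g where "h - [:e:] = [:- \<beta>, 1:] * g"
    unfolding poly_eq_0_iff_dvd by (elim dvdE)
  then have "poly (h - [:e:]) l = poly ([:- \<beta>, 1:] * g) l" for l by (rule arg_cong)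
  then have g: "poly h l = (l - \<beta>) * poly g l + e" for l
    by (simp add: algebra_simps)
  \<comment> \<open>At \<lambda> = \<beta> the left side vanishes, and \<partial> = 1 - \<beta>
    reduces the linear factor to \<alpha> - 1.\<close>
  have "e * ((\<alpha> - 1) * (1 - \<beta>) + \<alpha> * \<beta> - \<beta>) = 0"
    using eq[of \<beta> "1 - \<beta>"] by (simp add: e_def h)
  moreover have "(\<alpha> - 1) * (1 - \<beta>) + \<alpha> * \<beta> - \<beta> = \<alpha> - 1"
    by (simp add: algebra_simps)
  ultimately have e: "e * (\<alpha> - 1) = 0" by (simp only:)
  \<comment> \<open>\<open>r\<close> is the defect of the claimed decomposition; \<lambda> - \<beta>
    will annihilate it.\<close>
  define r where "r = p - plug g lam * (cst (\<alpha> - 1) * del + cst \<alpha> * lam - cst \<beta>) - cst e"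
  have r: "poly (poly r [:l:]) t =
      poly (poly p [:l:]) t - poly g l * ((\<alpha> - 1) * t + \<alpha> * l - \<beta>) - e" for l t
    by (simp add: r_def lam_def del_def cst_def algebra_simps)
  have "(l - \<beta>) * poly (poly r [:l:]) t = e * (\<alpha> - 1) * (t + l)" for l t
    using eq[of l t] g[of l] unfolding r h[symmetric] by algebra
  then have "r = 0"
    by (intro poly_poly_cancel_linear[of \<beta>]) (simp add: e)
  show ?thesis
  proof
    \<comment> \<open>The sign change in \<open>g\<close> matches the rule that \<partial> acts on
      the left entry of a bracket as -\<lambda>.\<close>
    show "poly (poly p [:l:]) t = poly (pcompose g [:0, - 1:]) (- l) * ((\<alpha> - 1) * t + \<alpha> * l - \<beta>) + e" for l t
      using r[of l t] by (simp add: \<open>r = 0\<close> poly_pcompose diff_eq_eq add.commute)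
  qed (use e in auto)
qed

section \<open>Derivations of an algebra of the common shape\<close>

text \<open>
  The common shape of both families, with \<open>[Y\<^sub>\<lambda> Y] = Q(\<lambda>, \<partial>) M\<close>.
\<close>

locale tsv_table =
  fixes P :: "gen \<Rightarrow> gen \<Rightarrow> tsv poly" and \<alpha> \<beta> :: "gen \<Rightarrow> complex"
    and Q :: "complex \<Rightarrow> complex \<Rightarrow> complex"
  assumes lie: "lie_conformal_algebra fscale (sesq_ext P)"
    and LL: "\<alpha> GL = 2" "\<beta> GL = 0"
    and L_left: "ev1 (P GL i) l t k = (if k = i then t + \<alpha> i * l + \<beta> i else 0)"
    and L_right: "ev1 (P i GL) l t k = (if k = i then (\<alpha> i - 1) * t + \<alpha> i * l - \<beta> i else 0)"
    and YY: "ev1 (P GY GY) l t k = (if k = GM then Q l t else 0)"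
    and M: "P GY GM = 0" "P GM GY = 0" "P GM GM = 0"
    and Q: "\<exists>t. Q (\<beta> GM - \<beta> GY) t \<noteq> 0"
begin

lemmas table = LL L_left L_right YY M gsum

text \<open>Brackets of \<open>M\<close> with \<open>M\<close> and \<open>Y\<close> vanish, so only
  the pair \<open>L\<close>, \<open>L\<close> matters: there the \<beta> terms cancel and both sides
  are e(\<partial> + \<lambda> + 2\<mu>)M.\<close>

lemma Rder_in_CDer:
  assumes "\<alpha> GM = 1"
  shows "Rder e \<in> CDer fscale (sesq_ext P)"
  unfolding CDer_def mem_Collect_eq conformal_derivation_iff
  by (auto simp: table assms algebra_simps)

text \<open>For \<alpha> = 1 the \<open>M\<close>-component of an inner derivation at
  \<open>L\<close> is a multiple of \<lambda> - \<beta>, hence zero at \<lambda> = \<beta>, while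
  that of \<open>Rder e\<close> is the constant \<open>e\<close>.\<close>

lemma Rder_in_CInn:
  assumes "\<alpha> GM = 1" "Rder e \<in> CInn (sesq_ext P)"
  shows "e = 0"
proof -
  obtain u where "Rder e = sesq_ext P u"
    using assms(2) by (auto simp: CInn_def conf_ad_def)
  then have "ev1 (Rder e (bas GL)) (\<beta> GM) 0 GM = ev1 (sesq_ext P u (bas GL)) (\<beta> GM) 0 GM"
    by simp
  then show ?thesis by (simp add: table assms(1))
qed

lemma derivation_vanishing:
  assumes d: "d \<in> CDer fscale (sesq_ext P)"
    and dL: "\<And>l t. ev1 (d (bas GL)) l t GL = 0" "\<And>l t. ev1 (d (bas GL)) l t GY = f"
      "\<And>l t. ev1 (d (bas GL)) l t GM = e"
  shows "d = Rder e"
proof -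
  have lin: "ev1 (d x) l t k = (\<Sum>i\<in>UNIV. poly (x i) (l + t) * ev1 (d (bas i)) l t k)" for x l t k
    using d unfolding CDer_def mem_Collect_eq conformal_derivation_iff by blast
  have der: "(\<Sum>i\<in>UNIV. ev1 (sesq_ext P x y) m (l + t) i * ev1 (d (bas i)) l t k) =
      (\<Sum>i\<in>UNIV. \<Sum>j\<in>UNIV. ev1 (d x) l (- (l + m)) i * poly (y j) (l + m + t) * ev1 (P i j) (l + m) t k) +
      (\<Sum>i\<in>UNIV. \<Sum>j\<in>UNIV. poly (x i) (- m) * ev1 (d y) l (m + t) j * ev1 (P i j) m t k)" for x y l m t k
    using d unfolding CDer_def mem_Collect_eq conformal_derivation_iff by blast
  \<comment> \<open>The constant \<open>e\<close> drops out because \<open>M\<close> brackets to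
    zero with \<open>M\<close> and \<open>Y\<close>.\<close>
  have act: "(l + \<beta> g - \<beta> k) * ev1 (d (bas g)) l t k =
      (if g = GY \<and> k = GM then f * Q l t else 0)" if "g \<noteq> GL" for g k l t
    using der[of "bas GL" "bas g" 0 l t k] that
    by (cases g; cases k) (auto simp: table dL algebra_simps)
  obtain t where "Q (\<beta> GM - \<beta> GY) t \<noteq> 0" using Q by blast
  with act[of GY "\<beta> GM - \<beta> GY" GM t] have "f = 0" by simp
  have "ev1 (d (bas g)) l t k = 0" if "g \<noteq> GL" for g k l t
  proof -
    have "kcomp k (d (bas g)) = 0"
      using act[OF that, of _ k] \<open>f = 0\<close>
      by (intro poly_poly_cancel_linear[of "\<beta> k - \<beta> g"]) (simp add: ev1_def algebra_simps)
    then show ?thesis by (simp add: ev1_def)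
  qed
  then show ?thesis
    apply (intro ext ev1_inj)
    subgoal for x l t k by (cases k) (simp_all add: lin[of x] gsum dL \<open>f = 0\<close>)
    done
qed

lemma derivation_decomposition:
  assumes d: "d \<in> CDer fscale (sesq_ext P)"
  obtains u e where "d = sesq_ext P u + Rder e" "\<alpha> GM \<noteq> 1 \<Longrightarrow> e = 0"
proof -
  have der: "(\<Sum>i\<in>UNIV. ev1 (sesq_ext P x y) m (l + t) i * ev1 (d (bas i)) l t k) =
      (\<Sum>i\<in>UNIV. \<Sum>j\<in>UNIV. ev1 (d x) l (- (l + m)) i * poly (y j) (l + m + t) * ev1 (P i j) (l + m) t k) +
      (\<Sum>i\<in>UNIV. \<Sum>j\<in>UNIV. poly (x i) (- m) * ev1 (d y) l (m + t) j * ev1 (P i j) m t k)" for x y l m t k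
    using d unfolding CDer_def mem_Collect_eq conformal_derivation_iff by blast
  have dL: "(l - \<beta> k) * ev1 (d (bas GL)) l t k =
      ev1 (d (bas GL)) l (- l) k * ((\<alpha> k - 1) * t + \<alpha> k * l - \<beta> k)" for k l t
    using der[of "bas GL" "bas GL" 0 l t k] by (cases k) (auto simp: table algebra_simps)
  have "\<exists>g e. (\<forall>l t. ev1 (d (bas GL)) l t k =
      poly g (- l) * ((\<alpha> k - 1) * t + \<alpha> k * l - \<beta> k) + e) \<and> (\<alpha> k \<noteq> 1 \<longrightarrow> e = 0)" for k
    by (rule L_value_decomposition[OF dL[unfolded ev1_def]]) (unfold ev1_def, blast)
  \<comment> \<open>The polynomials chosen for the three components are the coordinates of one
    element \<open>u\<close>, the generator of the inner part.\<close>
  then obtain u e where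
    u: "\<And>k l t. ev1 (d (bas GL)) l t k = poly (u k) (- l) * ((\<alpha> k - 1) * t + \<alpha> k * l - \<beta> k) + e k"
    and e: "\<And>k. \<alpha> k \<noteq> 1 \<Longrightarrow> e k = 0"
    by metis
  have "sesq_ext P u \<in> CDer fscale (sesq_ext P)"
    using CInn_subset_CDer[OF lie] by (auto simp: CInn_def conf_ad_def)
  then have "d - sesq_ext P u \<in> CDer fscale (sesq_ext P)"
    using module.subspace_diff[OF module_cscale subspace_CDer d] by blast
  \<comment> \<open>\<open>e GL\<close> is zero because \<alpha> is 2 at \<open>L\<close>.\<close>
  then have "d - sesq_ext P u = Rder (e GM)"
    by (rule derivation_vanishing[where f = "e GY"]) (simp_all add: table u e)
  then show ?thesis
    by (intro that[of u "e GM"]) (auto simp: algebra_simps e)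
qed

lemma CDer_eq_CInn:
  assumes "\<alpha> GM \<noteq> 1"
  shows "CDer fscale (sesq_ext P) = CInn (sesq_ext P)"
proof
  show "CDer fscale (sesq_ext P) \<subseteq> CInn (sesq_ext P)"
  proof
    fix d assume "d \<in> CDer fscale (sesq_ext P)"
    then obtain u where "d = sesq_ext P u"
      using derivation_decomposition assms Rder_0 by (metis add.right_neutral)
    then show "d \<in> CInn (sesq_ext P)" by (auto simp: CInn_def conf_ad_def)
  qed
qed (rule CInn_subset_CDer[OF lie])

lemma CDer_direct_sum:
  assumes "\<alpha> GM = 1"
  shows "is_direct_sum (cscale fscale) (CDer fscale (sesq_ext P)) (CInn (sesq_ext P)) {Rder e | e. True}"
  unfolding is_direct_sum_def
proof (intro conjI subspace_CDer subspace_CInn[OF lie] subspace_Rder)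
  show "CDer fscale (sesq_ext P) = {u + v | u v. u \<in> CInn (sesq_ext P) \<and> v \<in> {Rder e | e. True}}"
  proof (intro set_eqI iffI)
    fix d assume "d \<in> CDer fscale (sesq_ext P)"
    then obtain u e where "d = sesq_ext P u + Rder e" by (rule derivation_decomposition)
    then show "d \<in> {u + v | u v. u \<in> CInn (sesq_ext P) \<and> v \<in> {Rder e | e. True}}"
      by (auto simp: CInn_def conf_ad_def)
  next
    fix d assume "d \<in> {u + v | u v. u \<in> CInn (sesq_ext P) \<and> v \<in> {Rder e | e. True}}"
    then show "d \<in> CDer fscale (sesq_ext P)"
      using CInn_subset_CDer[OF lie] Rder_in_CDer[OF assms]
        module.subspace_add[OF module_cscale subspace_CDer] by blast
  qed
  show "CInn (sesq_ext P) \<inter> {Rder e | e. True} = {0}"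
    using Rder_in_CInn[OF assms] Rder_0 module.subspace_0[OF module_cscale subspace_CInn[OF lie]]
    by (auto; metis)
qed

end

section \<open>The two families as instances\<close>

text \<open>The arguments of \<open>TSV_\<alpha>\<close> are \<open>\<alpha>\<^sub>M\<close> and \<open>\<alpha>\<^sub>Y\<close>; the \<open>\<beta>\<^sub>x\<close> are the same for both families.\<close>

fun TSV_\<alpha> :: "complex \<Rightarrow> complex \<Rightarrow> gen \<Rightarrow> complex" where
  "TSV_\<alpha> m y GL = 2" | "TSV_\<alpha> m y GM = m" | "TSV_\<alpha> m y GY = y"

fun TSV_\<beta> :: "complex \<Rightarrow> gen \<Rightarrow> complex" where
  "TSV_\<beta> b GL = 0" | "TSV_\<beta> b GM = 2 * b" | "TSV_\<beta> b GY = b"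

lemma tsv_table_TSV:
  "tsv_table (TSV_table a b) (TSV_\<alpha> (2 * (a - 1)) a) (TSV_\<beta> b) (\<lambda>l t. t + 2 * l)"
proof (rule tsv_table.intro)
  show "lie_conformal_algebra fscale (sesq_ext (TSV_table a b))"
    using lie_conformal_TSV[of a b] by (simp add: TSV_def)
  show "ev1 (TSV_table a b GL i) l t k =
      (if k = i then t + TSV_\<alpha> (2 * (a - 1)) a i * l + TSV_\<beta> b i else 0)" for i l t k
    by (cases i) (simp_all add: evs algebra_simps)
  show "ev1 (TSV_table a b i GL) l t k =
      (if k = i then (TSV_\<alpha> (2 * (a - 1)) a i - 1) * t + TSV_\<alpha> (2 * (a - 1)) a i * l - TSV_\<beta> b i else 0)"
    for i l t k
    by (cases i) (simp_all add: evs algebra_simps)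
  \<comment> \<open>Here \<lambda> = b, and the witness gives the value 1.\<close>
  show "\<exists>t. t + 2 * (TSV_\<beta> b GM - TSV_\<beta> b GY) \<noteq> 0"
    by (rule exI[of _ "1 - 2 * b"]) (simp add: algebra_simps)
  show "TSV_table a b GM GY = 0"
    by (rule ev1_inj) simp
qed (simp_all add: evs)

lemma tsv_table_TSVc:
  "tsv_table (TSVc_table c) (TSV_\<alpha> 0 (3/2)) (TSV_\<beta> c) (\<lambda>l t. (t + 2 * l) * (- t - 2 * c))"
proof (rule tsv_table.intro)
  show "lie_conformal_algebra fscale (sesq_ext (TSVc_table c))"
    using lie_conformal_TSVc[of c] by (simp add: TSVc_def)
  show "ev1 (TSVc_table c GL i) l t k =
      (if k = i then t + TSV_\<alpha> 0 (3/2) i * l + TSV_\<beta> c i else 0)" for i l t k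
    by (cases i) (simp_all add: evs algebra_simps)
  show "ev1 (TSVc_table c i GL) l t k =
      (if k = i then (TSV_\<alpha> 0 (3/2) i - 1) * t + TSV_\<alpha> 0 (3/2) i * l - TSV_\<beta> c i else 0)"
    for i l t k
    by (cases i) (simp_all add: evs field_simps)
  \<comment> \<open>Here \<lambda> = c; both factors involve \<open>t + 2 * c\<close>, and the
    witness gives the value -1.\<close>
  show "\<exists>t. (t + 2 * (TSV_\<beta> c GM - TSV_\<beta> c GY)) * (- t - 2 * c) \<noteq> 0"
    by (rule exI[of _ "1 - 2 * c"]) (simp add: algebra_simps)
  show "TSVc_table c GM GY = 0"
    by (rule ev1_inj) simp
qed (simp_all add: evs algebra_simps)

theorem theorem5p3:
  fixes a b c :: complex
  shows
    "(a \<noteq> 3/2 \<longrightarrow> CDer fscale (TSV a b) = CInn (TSV a b)) \<and>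
     (a = 3/2 \<longrightarrow>
        (\<forall>b0. b0 \<noteq> 0 \<longrightarrow>
           Rder b0 \<in> CDer fscale (TSV (3/2) b) \<and> Rder b0 \<notin> CInn (TSV (3/2) b) \<and>
           Rder b0 (bas GL) = [:fscale [:b0:] (bas GM):] \<and>
           Rder b0 (bas GM) = 0 \<and> Rder b0 (bas GY) = 0) \<and>
        Rder 0 = 0 \<and>
        is_direct_sum (cscale fscale)
          (CDer fscale (TSV (3/2) b)) (CInn (TSV (3/2) b)) {Rder b0 | b0. True}) \<and>
     CDer fscale (TSVc c) = CInn (TSVc c)"
proof -
  interpret T: tsv_table "TSV_table a b" "TSV_\<alpha> (2 * (a - 1)) a" "TSV_\<beta> b" "\<lambda>l t. t + 2 * l"
    by (rule tsv_table_TSV)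
  interpret T3: tsv_table "TSV_table (3/2) b" "TSV_\<alpha> (2 * (3/2 - 1)) (3/2)" "TSV_\<beta> b"
      "\<lambda>l t. t + 2 * l"
    by (rule tsv_table_TSV)
  interpret Tc: tsv_table "TSVc_table c" "TSV_\<alpha> 0 (3/2)" "TSV_\<beta> c"
      "\<lambda>l t. (t + 2 * l) * (- t - 2 * c)"
    by (rule tsv_table_TSVc)
  have "CDer fscale (TSV a b) = CInn (TSV a b)" if "a \<noteq> 3/2"
    using T.CDer_eq_CInn that by (simp add: TSV_def field_simps)
  moreover have "TSV_\<alpha> (2 * (3/2 - 1)) (3/2) GM = 1" by simp
  note T3.Rder_in_CDer[OF this, folded TSV_def] T3.Rder_in_CInn[OF this, folded TSV_def]
    T3.CDer_direct_sum[OF this, folded TSV_def]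
  moreover have "CDer fscale (TSVc c) = CInn (TSVc c)"
    using Tc.CDer_eq_CInn by (simp add: TSVc_def)
  ultimately show ?thesis using Rder_basis Rder_0 by blast
qed

end
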